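(* Let $a,b,\nu\in\mathbb{C}$ and suppose that $(w_n)_{n\in\mathbb{Z}}$ is a solution (with non-zero terms) of the recurrence (P.iv) $$w_{n+4}w_{n+3}w_{n+2}+w_{n+2}w_{n+1}w_n+2w_{n+2}^2(w_{n+3}+w_{n+1})+w_{n+2}(w_{n+3}^2+w_{n+3}w_{n+1}+w_{n+1}^2)+w_{n+2}^3+\nu w_{n+2}(w_{n+3}+w_{n+2}+w_{n+1})+bw_{n+2}+a=0 .$$ Let $(\tau_n)_{n\in\mathbb{Z}}$ be a corresponding sequence of non-zero tau functions, i.e. $w_n=\dfrac{\tau_n\tau_{n+3}}{\tau_{n+1}\tau_{n+2}}$ for all $n$. Then $(\tau_n)$ satisfies, for all $n\in\mathbb{Z}$: (1) the homogeneous recurrence of order 7 and degree 8 $$\begin{aligned}&\tau_{n+7}\tau_{n+4}^2\tau_{n+3}^3\tau_{n+2}^2+\tau_{n+6}^2\tau_{n+3}^4\tau_{n+2}^2+2\tau_{n+6}\tau_{n+5}^2\tau_{n+3}^2\tau_{n+2}^3+\tau_{n+6}\tau_{n+5}\tau_{n+4}^2\tau_{n+3}^2\tau_{n+2}\tau_{n+1}\\&+\tau_{n+5}^4\tau_{n+2}^4+2\tau_{n+5}^3\tau_{n+4}^2\tau_{n+2}^2\tau_{n+1}+\tau_{n+5}^2\tau_{n+4}^4\tau_{n+1}^2+\tau_{n+5}^2\tau_{n+4}^3\tau_{n+3}^2\tau_n\\&+\nu(\tau_{n+6}\tau_{n+5}\tau_{n+4}\tau_{n+3}^3\tau_{n+2}^2+\tau_{n+5}^3\tau_{n+4}\tau_{n+3}\tau_{n+2}^3+\tau_{n+5}^2\tau_{n+4}^3\tau_{n+3}\tau_{n+2}\tau_{n+1})\\&+b\,\tau_{n+5}^2\tau_{n+4}^2\tau_{n+3}^2\tau_{n+2}^2+a\,\tau_{n+5}\tau_{n+4}^3\tau_{n+3}^3\tau_{n+2}=0;\end{aligned}$$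 (2) the (generalized) Somos-9 recurrence $$\alpha_1\tau_{n+9}\tau_n+\alpha_2\tau_{n+8}\tau_{n+1}+\alpha_3\tau_{n+7}\tau_{n+2}+\alpha_4\tau_{n+6}\tau_{n+3}+\alpha_5\tau_{n+5}\tau_{n+4}=0,$$ whose coefficients are constant along the orbit $(w_n)$ and are given by $\alpha_1=k_1$, $\alpha_2=ak_2-k_1^2$, $\alpha_3=a(ak_2-2k_1^2)$, $\alpha_4=a(k_2^2+\nu k_1k_2+bk_1^2+a^2k_1)$, $\alpha_5=-k_1(k_2^2+\nu k_1k_2+bk_1^2+a^2k_1)$, where $k_1,k_2$ are the values of the invariants $K_1,K_2$ on the orbit.
   Context: The invariants (first integrals) of the recurrence are $K_1=w_1w_2\big(w_2w_3+w_0w_1-w_0w_3+(w_1+w_2)^2+\nu(w_1+w_2)+b\big)+a(w_1+w_2)$ and $K_2=w_1w_2\big(w_0^2w_1+w_3^2w_2+w_0w_3(w_1+w_2)+w_0(w_2^2+2w_1^2)+w_3(w_1^2+2w_2^2)+3(w_0+w_3)w_1w_2+(w_1+w_2)^3+\nu(w_0w_3+(w_0+w_3)(w_1+w_2)+(w_1+w_2)^2)+b(w_0+w_1+w_2+w_3)\big)+a\big(w_0w_1+w_3w_2+(w_1+w_2)^2\big)$; their values are unchanged when $(w_0,w_1,w_2,w_3)$ is replaced by any four consecutive terms $(w_n,w_{n+1},w_{n+2},w_{n+3})$ of a solution. *)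

theory Defs
  imports Complex_Main
begin

definition piv_solution ::
  "complex \<Rightarrow> complex \<Rightarrow> complex \<Rightarrow> (int \<Rightarrow> complex) \<Rightarrow> bool" where
  "piv_solution a b \<nu> w \<longleftrightarrow>
     (\<forall>n. w (n+4) * w (n+3) * w (n+2) + w (n+2) * w (n+1) * w n
          + 2 * (w (n+2))\<^sup>2 * (w (n+3) + w (n+1))
          + w (n+2) * ((w (n+3))\<^sup>2 + w (n+3) * w (n+1) + (w (n+1))\<^sup>2)
          + w (n+2) ^ 3
          + \<nu> * w (n+2) * (w (n+3) + w (n+2) + w (n+1))
          + b * w (n+2) + a = 0)"

definition tau_sequence :: "(int \<Rightarrow> complex) \<Rightarrow> (int \<Rightarrow> complex) \<Rightarrow> bool" where
  "tau_sequence w \<tau> \<longleftrightarrow>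
     (\<forall>n. \<tau> n \<noteq> 0) \<and> (\<forall>n. w n = \<tau> n * \<tau> (n+3) / (\<tau> (n+1) * \<tau> (n+2)))"

definition K1 ::
  "complex \<Rightarrow> complex \<Rightarrow> complex \<Rightarrow> complex \<Rightarrow> complex \<Rightarrow> complex \<Rightarrow> complex \<Rightarrow> complex" where
  "K1 a b \<nu> w0 w1 w2 w3 =
     w1 * w2 * (w2 * w3 + w0 * w1 - w0 * w3 + (w1 + w2)\<^sup>2 + \<nu> * (w1 + w2) + b)
     + a * (w1 + w2)"

definition K2 ::
  "complex \<Rightarrow> complex \<Rightarrow> complex \<Rightarrow> complex \<Rightarrow> complex \<Rightarrow> complex \<Rightarrow> complex \<Rightarrow> complex" where
  "K2 a b \<nu> w0 w1 w2 w3 =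
     w1 * w2 * (w0\<^sup>2 * w1 + w3\<^sup>2 * w2 + w0 * w3 * (w1 + w2)
       + w0 * (w2\<^sup>2 + 2 * w1\<^sup>2) + w3 * (w1\<^sup>2 + 2 * w2\<^sup>2)
       + 3 * (w0 + w3) * w1 * w2 + (w1 + w2) ^ 3
       + \<nu> * (w0 * w3 + (w0 + w3) * (w1 + w2) + (w1 + w2)\<^sup>2)
       + b * (w0 + w1 + w2 + w3))
     + a * (w0 * w1 + w3 * w2 + (w1 + w2)\<^sup>2)"

end

theory Submission
  imports Defs
begin

text \<open>
  For five consecutive terms \<open>u, x, y, z, v\<close> of an orbit and \<open>T = u+x+y+z+v+\<nu>\<close>, the
  recurrence gives \<open>K1 = a*y - x*y*z*T\<close> and \<open>K2 = K1*(x+y+z) - x*z*(a + y*u*v)\<close>. These forms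
  are symmetric under reversal, as are \<open>K1\<close> and \<open>K2\<close>, so both four-term windows
  of the five terms give the same values, which is the invariance.

  Divided by \<open>\<tau> (n+5) * \<tau> (n+4)\<close>, the Somos-9 relation becomes a polynomial relation
  between the seven terms \<open>w n, ..., w (n+6)\<close>. Take the middle five of them as \<open>u, x, y, z, v\<close>.
  The outer two enter only through the products \<open>L = w n * u * x\<close> and \<open>M = z * v * w (n+6)\<close>,
  and the recurrence gives \<open>y*L = x*(a - u*y*(T-v)) - K1\<close> and
  \<open>y*M = z*(a - v*y*(T-u)) - K1\<close>. What remains is a polynomial identity.
\<close>

lemma int_shift_invariant_imp_constant:
  fixes f :: "int \<Rightarrow> 'a"
  assumes "\<And>n. f (n+1) = f n"
  shows "f n = f m"
proof (induction n rule: int_induct[where k = m])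
  case (step2 i)
  then show ?case using assms[of "i-1"] by simp
qed (simp_all add: assms)

text \<open>Factoring out \<open>w (n+2)\<close> gives the shape of the hypothesis of the five-term
  lemmas below, so that they apply by unification.\<close>

lemma piv_solution_recurrence:
  assumes "piv_solution a b \<nu> w"
  shows "w (n+2) * (w (n+3) * w (n+4) + w n * w (n+1) + 2 * w (n+2) * (w (n+3) + w (n+1))
     + (w (n+3))\<^sup>2 + w (n+3) * w (n+1) + (w (n+1))\<^sup>2 + (w (n+2))\<^sup>2
     + \<nu> * (w (n+3) + w (n+2) + w (n+1)) + b) + a = 0"
proof -
  note assms[unfolded piv_solution_def, rule_format, of n]
  then show ?thesis by algebra
qed

lemma K1_rev: "K1 a b \<nu> w3 w2 w1 w0 = K1 a b \<nu> w0 w1 w2 w3"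
  unfolding K1_def by algebra

lemma K2_rev: "K2 a b \<nu> w3 w2 w1 w0 = K2 a b \<nu> w0 w1 w2 w3"
  unfolding K2_def by algebra

text \<open>Subtracting \<open>x\<close> times the recurrence from \<open>K1\<close> cancels
  \<open>b\<close>, and every term left in the bracket has the factor \<open>z\<close>.\<close>

lemma K1_five_term:
  fixes u x y z v :: complex
  assumes "y * (z*v + u*x + 2*y*(z+x) + z\<^sup>2 + z*x + x\<^sup>2 + y\<^sup>2 + \<nu>*(z+y+x) + b) + a = 0"
  shows "K1 a b \<nu> u x y z = a*y - x*y*z*(u+x+y+z+v+\<nu>)"
  using assms unfolding K1_def by algebra

lemma K2_five_term:
  fixes u x y z v :: complex
  assumes "y * (z*v + u*x + 2*y*(z+x) + z\<^sup>2 + z*x + x\<^sup>2 + y\<^sup>2 + \<nu>*(z+y+x) + b) + a = 0"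
  shows "K2 a b \<nu> u x y z = K1 a b \<nu> u x y z * (x+y+z) - x*z*(a + y*u*v)"
proof -
  \<comment> \<open>An identity that holds without the recurrence. By \<open>K1_five_term\<close>,
    the terms with factor \<open>u\<close> then collapse to \<open>- x*y*z*u*v\<close>.\<close>
  have "K2 a b \<nu> u x y z
      = K1 a b \<nu> u x y z * (u+x+y+z) + x*z*u*y*(u+x+y+z+\<nu>) - a*(u*y + x*z)"
    unfolding K1_def K2_def by algebra
  then show ?thesis
    using K1_five_term[OF assms] by algebra
qed

lemma five_term_shift:
  assumes R: "y * (z*v + u*x + 2*y*(z+x) + z\<^sup>2 + z*x + x\<^sup>2 + y\<^sup>2 + \<nu>*(z+y+x) + b) + a = 0"
  shows "K1 a b \<nu> x y z v = K1 a b \<nu> u x y z" and "K2 a b \<nu> x y z v = K2 a b \<nu> u x y z"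
proof -
  \<comment> \<open>The recurrence read backwards: the five-term forms then also evaluate the window
    \<open>v, z, y, x\<close>.\<close>
  have R': "y * (x*u + v*z + 2*y*(x+z) + x\<^sup>2 + x*z + z\<^sup>2 + y\<^sup>2 + \<nu>*(x+y+z) + b) + a = 0"
    using R by (simp add: ac_simps)
  show K1: "K1 a b \<nu> x y z v = K1 a b \<nu> u x y z"
    using K1_five_term[OF R] K1_five_term[OF R'] K1_rev[of a b \<nu> v z y x] by (simp add: ac_simps)
  show "K2 a b \<nu> x y z v = K2 a b \<nu> u x y z"
    using K2_five_term[OF R] K2_five_term[OF R'] K1 K1_rev[of a b \<nu> v z y x]
      K2_rev[of a b \<nu> v z y x] by (simp add: ac_simps)
qed

text \<open>This is the five-term form \<open>K1 = a*x - u*x*y*(t+u+x+y+z+\<nu>)\<close> centred at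
  \<open>x\<close>, solved for the term that contains \<open>t\<close>.\<close>

lemma outer_product:
  fixes t u x y z v k1 :: complex
  assumes "x * (y*z + t*u + 2*x*(y+u) + y\<^sup>2 + y*u + u\<^sup>2 + x\<^sup>2 + \<nu>*(y+x+u) + b) + a = 0"
  shows "y*(t*u*x) = x*(a - u*y*(u+x+y+z+\<nu>)) - K1 a b \<nu> u x y z"
  using assms unfolding K1_def by algebra

lemma somos9_identity:
  fixes a b \<nu> k1 k2 u x y z v T L M Q :: complex
  assumes R: "y * (z*v + u*x + 2*y*(z+x) + z\<^sup>2 + z*x + x\<^sup>2 + y\<^sup>2 + \<nu>*(z+y+x) + b) + a = 0"
    and T: "T = u+x+y+z+v+\<nu>"
    and k1: "k1 = a*y - x*y*z*T"
    and k2: "k2 = k1*(x+y+z) - x*z*(a + y*u*v)"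
    and Q: "Q = k2\<^sup>2 + \<nu>*k1*k2 + b*k1\<^sup>2 + a\<^sup>2*k1"
    and L: "y*L = x*(a - u*y*(T-v)) - k1"
    and M: "y*M = z*(a - v*y*(T-u)) - k1"
  shows "k1 * (L*M*x*y\<^sup>2*z) + (a*k2 - k1\<^sup>2) * (u*x*y\<^sup>2*z*v) + a*(a*k2 - 2*k1\<^sup>2)*(x*y*z)
    + a*Q*y - k1*Q = 0"
proof -
  define g where "g = x*z*(a+y*u*v)"
  define e where "e = x+y+z"
  have yb: "y*b = - a - y*(z*v + u*x + e\<^sup>2 - x*z + \<nu>*e)"
    using R unfolding e_def by algebra
  have \<nu>: "\<nu> = T-u-v-e"
    unfolding T e_def by simp
  have k2': "k2 = k1*e - g"
    unfolding k2 g_def e_def by simp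
  have yQ: "y*Q = y*(g\<^sup>2 - k1*g*(e+T-u-v)) - a*k1\<^sup>2 - k1\<^sup>2*y*(z*v+x*u-x*z) + a\<^sup>2*y*k1"
    using yb unfolding Q k2' \<nu> by algebra
  \<comment> \<open>After the substitutions \<open>b\<close> and \<open>\<nu>\<close> are gone, and
    this is an identity in \<open>a, u, x, y, z, v\<close> with \<open>T\<close> as a free
    variable.\<close>
  have S: "k1*(y*L)*(y*M) + (a*k2-k1\<^sup>2)*y\<^sup>2*u*v + a*(a*k2-2*k1\<^sup>2)*y + T*(y*Q) = 0"
    unfolding L M yQ k2' g_def e_def unfolding k1 by algebra
  \<comment> \<open>Since \<open>a*y - k1 = x*y*z*T\<close>, the last two terms of the goal share
    the factor \<open>x*z\<close> with the other three.\<close>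
  have "a*Q*y - k1*Q = x*z*T*(y*Q)"
    unfolding k1 by algebra
  then have "k1 * (L*M*x*y\<^sup>2*z) + (a*k2 - k1\<^sup>2) * (u*x*y\<^sup>2*z*v) + a*(a*k2 - 2*k1\<^sup>2)*(x*y*z)
    + a*Q*y - k1*Q
    = x*z*(k1*(y*L)*(y*M) + (a*k2-k1\<^sup>2)*y\<^sup>2*u*v + a*(a*k2-2*k1\<^sup>2)*y + T*(y*Q))"
    by algebra
  then show ?thesis unfolding S by simp
qed

text \<open>Each product of taus arises from the one before by a factor that telescopes:
  \<open>w (n+3)\<close>, then \<open>w (n+2) * w (n+4)\<close>, then
  \<open>w (n+1) * w (n+3) * w (n+5)\<close>, and so on. The last right-hand side is grouped to
  display \<open>L\<close> and \<open>M\<close>.\<close>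

lemma tau_ratios:
  fixes \<tau> :: "int \<Rightarrow> complex"
  assumes nz: "\<And>k. \<tau> k \<noteq> 0"
    and w: "\<And>k. w k = \<tau> k * \<tau> (k+3) / (\<tau> (k+1) * \<tau> (k+2))"
  shows "\<tau> (n+6) * \<tau> (n+3) = w (n+3) * (\<tau> (n+5) * \<tau> (n+4))"
    and "\<tau> (n+7) * \<tau> (n+2) = w (n+2) * w (n+3) * w (n+4) * (\<tau> (n+5) * \<tau> (n+4))"
    and "\<tau> (n+8) * \<tau> (n+1)
      = w (n+1) * w (n+2) * (w (n+3))\<^sup>2 * w (n+4) * w (n+5) * (\<tau> (n+5) * \<tau> (n+4))"
    and "\<tau> (n+9) * \<tau> n
      = (w n * w (n+1) * w (n+2)) * (w (n+4) * w (n+5) * w (n+6))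
        * w (n+2) * (w (n+3))\<^sup>2 * w (n+4) * (\<tau> (n+5) * \<tau> (n+4))"
  by (simp_all add: nz w add.assoc power2_eq_square)

theorem proposition2p1:
  fixes a b \<nu> :: complex and w \<tau> :: "int \<Rightarrow> complex"
  assumes "piv_solution a b \<nu> w"
    and "\<forall>n. w n \<noteq> 0"
    and "tau_sequence w \<tau>"
  shows "(\<forall>n.
      \<tau> (n+7) * \<tau> (n+4) ^ 2 * \<tau> (n+3) ^ 3 * \<tau> (n+2) ^ 2
      + \<tau> (n+6) ^ 2 * \<tau> (n+3) ^ 4 * \<tau> (n+2) ^ 2
      + 2 * \<tau> (n+6) * \<tau> (n+5) ^ 2 * \<tau> (n+3) ^ 2 * \<tau> (n+2) ^ 3
      + \<tau> (n+6) * \<tau> (n+5) * \<tau> (n+4) ^ 2 * \<tau> (n+3) ^ 2 * \<tau> (n+2) * \<tau> (n+1)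
      + \<tau> (n+5) ^ 4 * \<tau> (n+2) ^ 4
      + 2 * \<tau> (n+5) ^ 3 * \<tau> (n+4) ^ 2 * \<tau> (n+2) ^ 2 * \<tau> (n+1)
      + \<tau> (n+5) ^ 2 * \<tau> (n+4) ^ 4 * \<tau> (n+1) ^ 2
      + \<tau> (n+5) ^ 2 * \<tau> (n+4) ^ 3 * \<tau> (n+3) ^ 2 * \<tau> n
      + \<nu> * (\<tau> (n+6) * \<tau> (n+5) * \<tau> (n+4) * \<tau> (n+3) ^ 3 * \<tau> (n+2) ^ 2
            + \<tau> (n+5) ^ 3 * \<tau> (n+4) * \<tau> (n+3) * \<tau> (n+2) ^ 3
            + \<tau> (n+5) ^ 2 * \<tau> (n+4) ^ 3 * \<tau> (n+3) * \<tau> (n+2) * \<tau> (n+1))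
      + b * \<tau> (n+5) ^ 2 * \<tau> (n+4) ^ 2 * \<tau> (n+3) ^ 2 * \<tau> (n+2) ^ 2
      + a * \<tau> (n+5) * \<tau> (n+4) ^ 3 * \<tau> (n+3) ^ 3 * \<tau> (n+2) = 0)
    \<and> (\<exists>k1 k2 \<alpha>1 \<alpha>2 \<alpha>3 \<alpha>4 \<alpha>5.
      (\<forall>n. K1 a b \<nu> (w n) (w (n+1)) (w (n+2)) (w (n+3)) = k1)
      \<and> (\<forall>n. K2 a b \<nu> (w n) (w (n+1)) (w (n+2)) (w (n+3)) = k2)
      \<and> \<alpha>1 = k1
      \<and> \<alpha>2 = a * k2 - k1 ^ 2
      \<and> \<alpha>3 = a * (a * k2 - 2 * k1 ^ 2)
      \<and> \<alpha>4 = a * (k2 ^ 2 + \<nu> * k1 * k2 + b * k1 ^ 2 + a ^ 2 * k1)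
      \<and> \<alpha>5 = - k1 * (k2 ^ 2 + \<nu> * k1 * k2 + b * k1 ^ 2 + a ^ 2 * k1)
      \<and> (\<forall>n. \<alpha>1 * \<tau> (n+9) * \<tau> n + \<alpha>2 * \<tau> (n+8) * \<tau> (n+1)
             + \<alpha>3 * \<tau> (n+7) * \<tau> (n+2) + \<alpha>4 * \<tau> (n+6) * \<tau> (n+3)
             + \<alpha>5 * \<tau> (n+5) * \<tau> (n+4) = 0))"
proof (intro conjI allI)
  have nz: "\<tau> k \<noteq> 0" and w: "w k = \<tau> k * \<tau> (k+3) / (\<tau> (k+1) * \<tau> (k+2))" for k
    using assms(3) unfolding tau_sequence_def by blast+
  show "\<tau> (n+7) * \<tau> (n+4) ^ 2 * \<tau> (n+3) ^ 3 * \<tau> (n+2) ^ 2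
      + \<tau> (n+6) ^ 2 * \<tau> (n+3) ^ 4 * \<tau> (n+2) ^ 2
      + 2 * \<tau> (n+6) * \<tau> (n+5) ^ 2 * \<tau> (n+3) ^ 2 * \<tau> (n+2) ^ 3
      + \<tau> (n+6) * \<tau> (n+5) * \<tau> (n+4) ^ 2 * \<tau> (n+3) ^ 2 * \<tau> (n+2) * \<tau> (n+1)
      + \<tau> (n+5) ^ 4 * \<tau> (n+2) ^ 4
      + 2 * \<tau> (n+5) ^ 3 * \<tau> (n+4) ^ 2 * \<tau> (n+2) ^ 2 * \<tau> (n+1)
      + \<tau> (n+5) ^ 2 * \<tau> (n+4) ^ 4 * \<tau> (n+1) ^ 2
      + \<tau> (n+5) ^ 2 * \<tau> (n+4) ^ 3 * \<tau> (n+3) ^ 2 * \<tau> n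
      + \<nu> * (\<tau> (n+6) * \<tau> (n+5) * \<tau> (n+4) * \<tau> (n+3) ^ 3 * \<tau> (n+2) ^ 2
            + \<tau> (n+5) ^ 3 * \<tau> (n+4) * \<tau> (n+3) * \<tau> (n+2) ^ 3
            + \<tau> (n+5) ^ 2 * \<tau> (n+4) ^ 3 * \<tau> (n+3) * \<tau> (n+2) * \<tau> (n+1))
      + b * \<tau> (n+5) ^ 2 * \<tau> (n+4) ^ 2 * \<tau> (n+3) ^ 2 * \<tau> (n+2) ^ 2
      + a * \<tau> (n+5) * \<tau> (n+4) ^ 3 * \<tau> (n+3) ^ 3 * \<tau> (n+2) = 0" (is "?lhs = 0") for n
  proof -
    \<comment> \<open>The monomial multiplying \<open>a\<close> in the claim; it clears all
      denominators of the recurrence.\<close>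
    define M where "M = \<tau> (n+5) * \<tau> (n+4)^3 * \<tau> (n+3)^3 * \<tau> (n+2)"
    have "?lhs = M *
      (w (n+2) * (w (n+3) * w (n+4) + w n * w (n+1) + 2 * w (n+2) * (w (n+3) + w (n+1))
     + (w (n+3))\<^sup>2 + w (n+3) * w (n+1) + (w (n+1))\<^sup>2 + (w (n+2))\<^sup>2
     + \<nu> * (w (n+3) + w (n+2) + w (n+1)) + b) + a)"
      by (simp add: w nz add.assoc M_def divide_simps) algebra
    then show ?thesis using piv_solution_recurrence[OF assms(1)] by simp
  qed
  note rec = piv_solution_recurrence[OF assms(1)]
  define k1 where "k1 = K1 a b \<nu> (w 0) (w 1) (w 2) (w 3)"
  define k2 where "k2 = K2 a b \<nu> (w 0) (w 1) (w 2) (w 3)"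
  have k1: "K1 a b \<nu> (w n) (w (n+1)) (w (n+2)) (w (n+3)) = k1" for n
    using int_shift_invariant_imp_constant[of
        "\<lambda>n. K1 a b \<nu> (w n) (w (n+1)) (w (n+2)) (w (n+3))" n 0]
      five_term_shift(1)[OF rec] by (simp add: k1_def add.assoc)
  have k2: "K2 a b \<nu> (w n) (w (n+1)) (w (n+2)) (w (n+3)) = k2" for n
    using int_shift_invariant_imp_constant[of
        "\<lambda>n. K2 a b \<nu> (w n) (w (n+1)) (w (n+2)) (w (n+3))" n 0]
      five_term_shift(2)[OF rec] by (simp add: k2_def add.assoc)
  define Q where "Q = k2^2 + \<nu>*k1*k2 + b*k1^2 + a^2*k1"
  have somos9: "k1 * \<tau> (n+9) * \<tau> n + (a*k2 - k1^2) * \<tau> (n+8) * \<tau> (n+1)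
      + a*(a*k2 - 2*k1^2) * \<tau> (n+7) * \<tau> (n+2) + a*Q * \<tau> (n+6) * \<tau> (n+3)
      + - k1*Q * \<tau> (n+5) * \<tau> (n+4) = 0" for n
  proof -
    let ?u = "w (n+1)" and ?x = "w (n+2)" and ?y = "w (n+3)" and ?z = "w (n+4)" and ?v = "w (n+5)"
    let ?L = "w n * ?u * ?x" and ?M = "?z * ?v * w (n+6)"
    have R: "?y * (?z*?v + ?u*?x + 2*?y*(?z+?x) + ?z\<^sup>2 + ?z*?x + ?x\<^sup>2 + ?y\<^sup>2
        + \<nu>*(?z+?y+?x) + b) + a = 0"
      using rec[of "n+1"] by (simp add: add.assoc)
    \<comment> \<open>The recurrence centred at \<open>w (n+4)\<close>, written backwards so that
      \<open>w (n+6)\<close> takes the place of \<open>t\<close> in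
      \<open>outer_product\<close>.\<close>
    have "?z * (?y*?x + w (n+6)*?v + 2*?z*(?y+?v) + ?y\<^sup>2 + ?y*?v + ?v\<^sup>2 + ?z\<^sup>2
        + \<nu>*(?y+?z+?v) + b) + a = 0"
      using rec[of "n+2"] by (simp add: ac_simps)
    from outer_product[OF this]
    have M: "?y*?M = ?z*(a - ?v*?y*(?v+?z+?y+?x+\<nu>)) - k1"
      using k1[of "n+2"] by (simp add: K1_rev ac_simps)
    have L: "?y*?L = ?x*(a - ?u*?y*(?u+?x+?y+?z+\<nu>)) - k1"
      using outer_product[OF rec[of n]] k1[of "n+1"] by (simp add: add.assoc)
    have k1u: "K1 a b \<nu> ?u ?x ?y ?z = k1" and k2u: "K2 a b \<nu> ?u ?x ?y ?z = k2"
      using k1[of "n+1"] k2[of "n+1"] by (simp_all add: add.assoc)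
    define I where "I = k1 * (?L*?M*?x*?y\<^sup>2*?z) + (a*k2 - k1\<^sup>2) * (?u*?x*?y\<^sup>2*?z*?v)
        + a*(a*k2 - 2*k1\<^sup>2)*(?x*?y*?z) + a*Q*?y - k1*Q"
    have "I = 0"
      unfolding I_def
      by (rule somos9_identity[OF R refl K1_five_term[OF R, unfolded k1u]
          K2_five_term[OF R, unfolded k1u k2u] Q_def])
        (use L M in algebra)+
    moreover have "k1 * \<tau> (n+9) * \<tau> n + (a*k2 - k1^2) * \<tau> (n+8) * \<tau> (n+1)
      + a*(a*k2 - 2*k1^2) * \<tau> (n+7) * \<tau> (n+2) + a*Q * \<tau> (n+6) * \<tau> (n+3)
      + - k1*Q * \<tau> (n+5) * \<tau> (n+4) = I * (\<tau> (n+5) * \<tau> (n+4))"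
      \<comment> \<open>Reassociating brings the two taus of each term together, as
        \<open>tau_ratios\<close> expects.\<close>
      unfolding mult.assoc[of _ "\<tau> (n+9)"] mult.assoc[of _ "\<tau> (n+8)"] mult.assoc[of _ "\<tau> (n+7)"]
        mult.assoc[of _ "\<tau> (n+6)"] mult.assoc[of _ "\<tau> (n+5)"] tau_ratios[OF nz w] I_def
      by algebra
    ultimately show ?thesis by simp
  qed
  show "(\<exists>k1 k2 \<alpha>1 \<alpha>2 \<alpha>3 \<alpha>4 \<alpha>5.
      (\<forall>n. K1 a b \<nu> (w n) (w (n+1)) (w (n+2)) (w (n+3)) = k1)
      \<and> (\<forall>n. K2 a b \<nu> (w n) (w (n+1)) (w (n+2)) (w (n+3)) = k2)
      \<and> \<alpha>1 = k1
      \<and> \<alpha>2 = a * k2 - k1 ^ 2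
      \<and> \<alpha>3 = a * (a * k2 - 2 * k1 ^ 2)
      \<and> \<alpha>4 = a * (k2 ^ 2 + \<nu> * k1 * k2 + b * k1 ^ 2 + a ^ 2 * k1)
      \<and> \<alpha>5 = - k1 * (k2 ^ 2 + \<nu> * k1 * k2 + b * k1 ^ 2 + a ^ 2 * k1)
      \<and> (\<forall>n. \<alpha>1 * \<tau> (n+9) * \<tau> n + \<alpha>2 * \<tau> (n+8) * \<tau> (n+1)
             + \<alpha>3 * \<tau> (n+7) * \<tau> (n+2) + \<alpha>4 * \<tau> (n+6) * \<tau> (n+3)
             + \<alpha>5 * \<tau> (n+5) * \<tau> (n+4) = 0))"
    using k1 k2 somos9 unfolding Q_def by blast
qed

end
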